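(* Let $\mathcal{Z}$ be the set of bounded random variables on a standard atomless probability space $(\Omega,\mathcal{F},P)$, equipped with the norm topology of $\mathcal{L}_1(\Omega,\mathcal{F},P)$. If the total preorder $\succeq$ on $\mathcal{Z}$ is law invariant, continuous, monotonic, and satisfies the dual independence axiom for random variables, then there exists a bounded, nondecreasing, continuous function $w:[0,1]\to\mathbb{R}_+$ such that $$U(Z)=\int_0^1F_Z^{-1}(p)\,dw(p),\qquad Z\in\mathcal{Z},$$ is a numerical representation of $\succeq$.
   Context: $F_Z$ is the distribution function of $Z$ and $F_Z^{-1}(p)=\inf\{t:F_Z(t)\ge p\}$ its quantile function. Law invariant: equal distributions imply indifference. Continuous: for each $Z$ the sets $\{V:V\succeq Z\}$ and $\{V:Z\succeq V\}$ are closed in $\mathcal{L}_1$. Monotonic: $Z\ge V$ a.s. implies $Z\succeq V$. $Z,V$ comonotonic means $(Z(\omega)-Z(\omega'))(V(\omega)-V(\omega'))\ge0$ for all $\omega,\omega'$. Dual independence axiom for random variables: for all comonotonic $Z,V,W$, $Z\succ V$ implies $\alpha Z+(1-\alpha)W\succ\alpha V+(1-\alpha)W$ for all $\alpha\in(0,1)$. A total preorder is reflexive, transitive, complete; $\succ$ its strict part; $U$ is a numerical representation if $Z\succ V\iff U(Z)>U(V)$. *)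

theory Defs
  imports "HOL-Probability.Probability"
begin

definition atomless :: "'a measure \<Rightarrow> bool" where
  "atomless M \<longleftrightarrow> (\<forall>A\<in>sets M. measure M A > 0 \<longrightarrow>
      (\<exists>B\<in>sets M. B \<subseteq> A \<and> 0 < measure M B \<and> measure M B < measure M A))"

definition bounded_rvs :: "'a measure \<Rightarrow> ('a \<Rightarrow> real) set" where
  "bounded_rvs M = {Z. Z \<in> borel_measurable M \<and> (\<exists>c. AE \<omega> in M. \<bar>Z \<omega>\<bar> \<le> c)}"

definition cdf_of :: "'a measure \<Rightarrow> ('a \<Rightarrow> real) \<Rightarrow> real \<Rightarrow> real" where
  "cdf_of M Z t = measure M {\<omega> \<in> space M. Z \<omega> \<le> t}"

definition quantile :: "'a measure \<Rightarrow> ('a \<Rightarrow> real) \<Rightarrow> real \<Rightarrow> real" where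
  "quantile M Z p = Inf {t. cdf_of M Z t \<ge> p}"

definition comonotonic :: "'a measure \<Rightarrow> ('a \<Rightarrow> real) \<Rightarrow> ('a \<Rightarrow> real) \<Rightarrow> bool" where
  "comonotonic M Z V \<longleftrightarrow> (\<forall>\<omega>\<in>space M. \<forall>\<omega>'\<in>space M. (Z \<omega> - Z \<omega>') * (V \<omega> - V \<omega>') \<ge> 0)"

definition strict :: "('b \<Rightarrow> 'b \<Rightarrow> bool) \<Rightarrow> 'b \<Rightarrow> 'b \<Rightarrow> bool" where
  "strict R x y \<longleftrightarrow> R x y \<and> \<not> R y x"

definition total_preorder_on :: "'b set \<Rightarrow> ('b \<Rightarrow> 'b \<Rightarrow> bool) \<Rightarrow> bool" where
  "total_preorder_on S R \<longleftrightarrow>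
     (\<forall>x\<in>S. R x x) \<and>
     (\<forall>x\<in>S. \<forall>y\<in>S. \<forall>z\<in>S. R x y \<longrightarrow> R y z \<longrightarrow> R x z) \<and>
     (\<forall>x\<in>S. \<forall>y\<in>S. R x y \<or> R y x)"

definition law_invariant :: "'a measure \<Rightarrow> (('a \<Rightarrow> real) \<Rightarrow> ('a \<Rightarrow> real) \<Rightarrow> bool) \<Rightarrow> bool" where
  "law_invariant M R \<longleftrightarrow> (\<forall>Z\<in>bounded_rvs M. \<forall>V\<in>bounded_rvs M.
      distr M borel Z = distr M borel V \<longrightarrow> R Z V \<and> R V Z)"

text \<open>Continuity: upper and lower contour sets are closed in Z w.r.t. the L1 norm
  (sequential closedness, equivalent since the L1 topology is (pseudo)metric).\<close>
definition L1_closed :: "'a measure \<Rightarrow> ('a \<Rightarrow> real) set \<Rightarrow> bool" where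
  "L1_closed M A \<longleftrightarrow> (\<forall>Vs V. (\<forall>n. Vs n \<in> A) \<longrightarrow> V \<in> bounded_rvs M \<longrightarrow>
      ((\<lambda>n. \<integral>\<omega>. \<bar>Vs n \<omega> - V \<omega>\<bar> \<partial>M) \<longlonglongrightarrow> 0) \<longrightarrow> V \<in> A)"

definition pref_continuous :: "'a measure \<Rightarrow> (('a \<Rightarrow> real) \<Rightarrow> ('a \<Rightarrow> real) \<Rightarrow> bool) \<Rightarrow> bool" where
  "pref_continuous M R \<longleftrightarrow> (\<forall>Z\<in>bounded_rvs M.
      L1_closed M {V\<in>bounded_rvs M. R V Z} \<and> L1_closed M {V\<in>bounded_rvs M. R Z V})"

definition pref_monotonic :: "'a measure \<Rightarrow> (('a \<Rightarrow> real) \<Rightarrow> ('a \<Rightarrow> real) \<Rightarrow> bool) \<Rightarrow> bool" where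
  "pref_monotonic M R \<longleftrightarrow> (\<forall>Z\<in>bounded_rvs M. \<forall>V\<in>bounded_rvs M.
      (AE \<omega> in M. Z \<omega> \<ge> V \<omega>) \<longrightarrow> R Z V)"

definition dual_independence :: "'a measure \<Rightarrow> (('a \<Rightarrow> real) \<Rightarrow> ('a \<Rightarrow> real) \<Rightarrow> bool) \<Rightarrow> bool" where
  "dual_independence M R \<longleftrightarrow> (\<forall>Z\<in>bounded_rvs M. \<forall>V\<in>bounded_rvs M. \<forall>W\<in>bounded_rvs M.
      comonotonic M Z V \<and> comonotonic M Z W \<and> comonotonic M V W \<longrightarrow> strict R Z V \<longrightarrow>
      (\<forall>\<alpha>::real. 0 < \<alpha> \<and> \<alpha> < 1 \<longrightarrow>
         strict R (\<lambda>\<omega>. \<alpha> * Z \<omega> + (1 - \<alpha>) * W \<omega>) (\<lambda>\<omega>. \<alpha> * V \<omega> + (1 - \<alpha>) * W \<omega>)))"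

text \<open>Lebesgue--Stieltjes integral over [0,1] against a function w given on [0,1]:
  w is extended constantly outside [0,1]; since the w of the theorem is continuous,
  the measure has no atom at 0, so integrating over (0,1] equals integrating over [0,1].\<close>
definition stieltjes_01 :: "(real \<Rightarrow> real) \<Rightarrow> (real \<Rightarrow> real) \<Rightarrow> real" where
  "stieltjes_01 w f = (LINT p:{0<..1}|interval_measure (\<lambda>x. w (max 0 (min 1 x))). f p)"

definition numerical_representation ::
  "'b set \<Rightarrow> ('b \<Rightarrow> 'b \<Rightarrow> bool) \<Rightarrow> ('b \<Rightarrow> real) \<Rightarrow> bool" where
  "numerical_representation S R U \<longleftrightarrow> (\<forall>Z\<in>S. \<forall>V\<in>S. strict R Z V \<longleftrightarrow> U Z > U V)"

end

theory Submission
  imports Defs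
begin

text \<open>
  Unless all random variables are indifferent, the preference is strictly increasing on constants,
  so by continuity every \<open>Z\<close> is indifferent to a unique constant, its certainty equivalent.
  Dual independence makes the certainty equivalent additive on comonotonic pairs. Atomlessness and
  law invariance give a continuous distortion \<open>g\<close> such that an indicator of an event of
  probability \<open>p\<close> has certainty equivalent \<open>g p\<close>. Approximating \<open>Z\<close> uniformly by step functions,
  that is by sums of indicators of its upper level sets, identifies the certainty equivalent with
  the Stieltjes integral of the quantile function against \<open>w p = 1 - g (1 - p)\<close>.
\<close>

section \<open>Atomless probability spaces\<close>

text \<open>Both parts of a proper splitting of \<open>A\<close> have positive mass, and the lighter
  one has at most half of the mass of \<open>A\<close>.\<close>

lemma atomless_halving:
  assumes "prob_space M" "atomless M" "A \<in> sets M" "measure M A > 0"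
  shows "\<exists>B\<in>sets M. B \<subseteq> A \<and> 0 < measure M B \<and> measure M B \<le> measure M A / 2"
proof -
  interpret prob_space M by fact
  obtain B where B: "B \<in> sets M" "B \<subseteq> A" "0 < prob B" "prob B < prob A"
    using assms unfolding atomless_def by blast
  have "prob (A - B) = prob A - prob B"
    using B assms by (intro finite_measure_Diff) auto
  then show ?thesis
    using B assms(3)
    by (cases "prob B \<le> prob A / 2") (auto intro: bexI[of _ "A - B"] bexI[of _ B])
qed

text \<open>Iterated halving. The small sets found here are what contradicts a premature stop of the
  exhaustion below.\<close>

lemma atomless_small:
  assumes "prob_space M" "atomless M" "A \<in> sets M" "measure M A > 0" "e > 0"
  shows "\<exists>B\<in>sets M. B \<subseteq> A \<and> 0 < measure M B \<and> measure M B < e"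
proof -
  have pow: "\<exists>B\<in>sets M. B \<subseteq> A \<and> 0 < measure M B \<and> measure M B \<le> measure M A / 2 ^ n" for n
  proof (induction n)
    case 0
    then show ?case using assms by auto
  next
    case (Suc n)
    then obtain B where B: "B \<in> sets M" "B \<subseteq> A" "0 < measure M B" "measure M B \<le> measure M A / 2 ^ n"
      by blast
    obtain C where C: "C \<in> sets M" "C \<subseteq> B" "0 < measure M C" "measure M C \<le> measure M B / 2"
      using atomless_halving[OF assms(1,2) B(1,3)] by blast
    have "measure M B / 2 \<le> measure M A / 2 ^ Suc n"
      using B(4) by simp
    with B C show ?case by (intro bexI[of _ C]) auto
  qed
  have "(\<lambda>n. measure M A / 2 ^ n) \<longlonglongrightarrow> 0"
    by (intro LIMSEQ_divide_realpow_zero) simp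
  then have "\<forall>\<^sub>F n in sequentially. measure M A / 2 ^ n < e"
    using \<open>e > 0\<close> by (rule order_tendstoD(2))
  then obtain n where "measure M A / 2 ^ n < e"
    by (auto simp: eventually_sequentially)
  then show ?thesis using pow[of n] by (meson order_le_less_trans)
qed

text \<open>Sierpinski's theorem, by greedy exhaustion: each step adds at least half of the mass that
  could be added without exceeding \<open>p\<close>.\<close>

lemma atomless_subset_of_measure:
  assumes "prob_space M" "atomless M" "A \<in> sets M" "0 \<le> p" "p \<le> measure M A"
  shows "\<exists>B\<in>sets M. B \<subseteq> A \<and> measure M B = p"
proof -
  interpret prob_space M by fact
  define adm where "adm B = {C \<in> sets M. C \<subseteq> A - B \<and> prob B + prob C \<le> p}" for B
  define s where "s B = (SUP C\<in>adm B. prob C)" for B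
  have bdd: "bdd_above (prob ` adm B)" for B
    by (intro bdd_aboveI[of _ 1]) auto
  have step: "\<exists>C\<in>adm B. prob C \<ge> s B / 2" if "prob B \<le> p" for B
  proof (cases "s B > 0")
    case True
    have ne: "adm B \<noteq> {}" using that by (auto simp: adm_def intro!: exI[of _ "{}"])
    have "s B / 2 < s B" using True by simp
    then show ?thesis
      unfolding s_def using less_cSUP_iff[OF ne bdd] by (meson less_imp_le)
  next
    case False
    then show ?thesis using that by (intro bexI[of _ "{}"]) (auto simp: adm_def)
  qed
  define good where "good B \<longleftrightarrow> B \<in> sets M \<and> B \<subseteq> A \<and> prob B \<le> p" for B
  have "\<exists>f. \<forall>n. good (f n) \<and> f n \<subseteq> f (Suc n) \<and> prob (f (Suc n)) \<ge> prob (f n) + s (f n) / 2"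
  proof (rule dependent_nat_choice[where P = "\<lambda>_. good" and
        Q = "\<lambda>_ x y. x \<subseteq> y \<and> prob y \<ge> prob x + s x / 2"])
    show "\<exists>x. good x" using assms by (auto simp: good_def intro!: exI[of _ "{}"])
    fix B :: "'a set" and n :: nat
    assume B: "good B"
    then obtain C where C: "C \<in> adm B" "prob C \<ge> s B / 2"
      using step by (auto simp: good_def)
    have "prob (B \<union> C) = prob B + prob C"
      using B C by (intro finite_measure_Union) (auto simp: good_def adm_def)
    then show "\<exists>y. good y \<and> B \<subseteq> y \<and> prob B + s B / 2 \<le> prob y"
      using B C by (intro exI[of _ "B \<union> C"]) (auto simp: good_def adm_def)
  qed
  then obtain f where good: "\<And>n. good (f n)" and sub: "\<And>n. f n \<subseteq> f (Suc n)"
    and inc: "\<And>n. prob (f (Suc n)) \<ge> prob (f n) + s (f n) / 2"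
    by blast
  define B where "B = (\<Union>n. f n)"
  have B: "B \<in> sets M" "B \<subseteq> A" using good by (auto simp: B_def good_def)
  have lim: "(\<lambda>n. prob (f n)) \<longlonglongrightarrow> prob B"
    unfolding B_def using good sub
    by (intro finite_Lim_measure_incseq incseq_SucI) (auto simp: good_def)
  then have le: "prob B \<le> p"
    using good by (intro LIMSEQ_le_const2[OF lim]) (auto simp: good_def)
  have "prob B = p"
  proof (rule ccontr)
    assume "prob B \<noteq> p"
    with le have lt: "prob B < p" by simp
    have "prob (A - B) = prob A - prob B"
      using B assms by (intro finite_measure_Diff) auto
    then have "prob (A - B) > 0" using lt assms by simp
    then obtain D where D: "D \<in> sets M" "D \<subseteq> A - B" "0 < prob D" "prob D < p - prob B"
      using atomless_small[OF assms(1,2), of "A - B" "p - prob B"] B assms lt by auto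
    \<comment> \<open>\<open>D\<close> fits into the gap left by the whole union, so it is
      admissible at every stage. Each increment is then at least \<open>prob D / 2\<close>, although
      the increments of a convergent sequence tend to 0.\<close>
    have "prob D \<le> s (f n)" for n
    proof -
      have "prob (f n) \<le> prob B"
        using B good by (intro finite_measure_mono) (auto simp: B_def)
      then have "D \<in> adm (f n)" using D by (auto simp: adm_def B_def)
      then show ?thesis unfolding s_def using bdd by (intro cSUP_upper) auto
    qed
    then have ge: "prob (f (Suc n)) - prob (f n) \<ge> prob D / 2" for n
      using inc[of n] by (smt (verit) field_sum_of_halves)
    have "(\<lambda>n. prob (f (Suc n)) - prob (f n)) \<longlonglongrightarrow> prob B - prob B"
      using lim by (intro tendsto_diff) (auto intro: LIMSEQ_Suc)
    from LIMSEQ_le_const[OF this] ge have "prob D / 2 \<le> prob B - prob B" by blast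
    with D show False by simp
  qed
  with B show ?thesis by blast
qed

section \<open>Rounding a real number up to a grid\<close>

text \<open>Exactly \<open>\<lceil>y / h\<rceil>\<close> grid points \<open>k * h\<close> lie
  strictly below \<open>y\<close>, so the sum rounds \<open>y\<close> up to a multiple of
  \<open>h\<close>. It is applied both to quantiles and to values of \<open>Z\<close>, each shifted
  by \<open>K\<close>.\<close>

lemma step_approximation:
  fixes h y :: real
  assumes "h > 0" "0 \<le> y" "y \<le> real N * h"
  shows "y \<le> h * (\<Sum>k<N. of_bool (real k * h < y))"
    and "h * (\<Sum>k<N. of_bool (real k * h < y)) \<le> y + h"
proof -
  define m where "m = nat \<lceil>y / h\<rceil>"
  have m: "real m = of_int \<lceil>y / h\<rceil>" using assms by (simp add: m_def)
  have mN: "m \<le> N" using assms unfolding m_def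
    by (simp add: nat_le_iff ceiling_le_iff divide_le_eq)
  have "real k * h < y \<longleftrightarrow> k < m" for k
  proof -
    have "real k * h < y \<longleftrightarrow> real k < y / h" using assms by (simp add: less_divide_eq)
    also have "\<dots> \<longleftrightarrow> int k < \<lceil>y / h\<rceil>" by (simp add: less_ceiling_iff)
    also have "\<dots> \<longleftrightarrow> k < m" unfolding m_def by linarith
    finally show ?thesis .
  qed
  then have "(\<Sum>k<N. of_bool (real k * h < y)) = (\<Sum>k<N. of_bool (k < m) :: real)" by simp
  also have "\<dots> = real (card ({..<N} \<inter> {k. k < m}))" by (simp add: sum_of_bool_eq)
  also have "{..<N} \<inter> {k. k < m} = {..<m}" using mN by auto
  finally have *: "(\<Sum>k<N. of_bool (real k * h < y)) = real m" by simp
  have "y / h \<le> real m" "real m \<le> y / h + 1" unfolding m by linarith+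
  then show "y \<le> h * (\<Sum>k<N. of_bool (real k * h < y))"
    "h * (\<Sum>k<N. of_bool (real k * h < y)) \<le> y + h"
    unfolding * using assms by (auto simp: field_simps)
qed

section \<open>Quantiles and Stieltjes integrals\<close>


text \<open>Galois connection between quantile and distribution function. Right-continuity of the
  latter makes the infimum attained; \<open>0 < p\<close> bounds the set from below and
  \<open>p \<le> 1\<close> puts \<open>K\<close> into it.\<close>

lemma quantile_less_iff:
  assumes "prob_space M" and Z: "Z \<in> borel_measurable M"
    and K: "AE x in M. \<bar>Z x\<bar> \<le> K" and p: "0 < p" "p \<le> 1"
  shows "t < quantile M Z p \<longleftrightarrow> cdf_of M Z t < p"
proof -
  interpret prob_space M by fact
  note [measurable] = Z
  interpret D: real_distribution "distr M borel Z" by simp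
  have F: "cdf_of M Z = cdf (distr M borel Z)"
    by (auto simp: fun_eq_iff cdf_of_def cdf_def measure_distr vimage_def Int_def conj_commute)
  let ?S = "{t. p \<le> cdf_of M Z t}"
  have "prob {x \<in> space M. Z x \<le> K} = 1"
    using K by (subst prob_Collect_eq_1) (auto elim: eventually_mono)
  then have ne: "K \<in> ?S" using p by (simp add: cdf_of_def)
  have "prob {x \<in> space M. Z x \<le> t} = 0" if "t < - K" for t
    using K that by (subst prob_Collect_eq_0) (auto elim: eventually_mono)
  then have low: "- K \<le> t" if "t \<in> ?S" for t
    using that p by (force simp: cdf_of_def not_le[symmetric])
  then have bdd: "bdd_below ?S" by (intro bdd_belowI)
  have "quantile M Z p \<le> t" if "p \<le> cdf_of M Z t"
    unfolding quantile_def using that bdd by (intro cInf_lower) auto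
  moreover have "p \<le> cdf_of M Z t" if q: "quantile M Z p \<le> t"
  proof -
    have "p \<le> cdf_of M Z u" if "t < u" for u
    proof -
      have "Inf ?S < u" using q that by (simp add: quantile_def)
      then obtain s where "s \<in> ?S" "s < u" using cInf_lessD[of ?S u] ne by blast
      then show ?thesis using D.cdf_nondecreasing[of s u] by (simp add: F)
    qed
    then have "\<forall>\<^sub>F u in at_right t. p \<le> cdf_of M Z u"
      by (intro eventually_at_rightI[of t "t + 1"]) auto
    moreover have "(cdf_of M Z \<longlongrightarrow> cdf_of M Z t) (at_right t)"
      using D.cdf_is_right_cont[of t] by (simp add: F continuous_within)
    ultimately show ?thesis
      by (intro tendsto_lowerbound[of _ _ "at_right t"]) auto
  qed
  ultimately show ?thesis by (meson not_le)
qed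

lemma quantile_bounds:
  assumes "prob_space M" and Z: "Z \<in> borel_measurable M"
    and K: "AE x in M. \<bar>Z x\<bar> \<le> K" and p: "0 < p" "p \<le> 1"
  shows "- K \<le> quantile M Z p" "quantile M Z p \<le> K"
proof -
  interpret prob_space M by fact
  note [measurable] = Z
  note less_iff = quantile_less_iff[OF assms]
  have "cdf_of M Z K = 1"
    unfolding cdf_of_def using K by (subst prob_Collect_eq_1) (auto elim: eventually_mono)
  then show "quantile M Z p \<le> K" using less_iff[of K] p by simp
  have "cdf_of M Z t = 0" if "t < - K" for t
    unfolding cdf_of_def using K that
    by (subst prob_Collect_eq_0) (auto elim: eventually_mono)
  then have "t < quantile M Z p" if "t < - K" for t using less_iff[of t] p that by simp
  then show "- K \<le> quantile M Z p" by (meson dense_le less_imp_le)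
qed

text \<open>By \<open>quantile_less_iff\<close>, the quantile exceeds \<open>k * h - K\<close>
  exactly on an interval \<open>{F<..1}\<close> with \<open>F = cdf_of M Z (k * h - K)\<close>, of
  Stieltjes mass \<open>w 1 - w F\<close>. Hence \<open>S\<close> is the integral of a staircase
  lying above the quantile function by at most \<open>h\<close>.\<close>

lemma stieltjes_quantile_bounds:
  fixes w :: "real \<Rightarrow> real"
  assumes "prob_space M" and Z: "Z \<in> borel_measurable M"
    and K: "AE x in M. \<bar>Z x\<bar> \<le> K" "K > 0"
    and w: "mono_on {0..1} w" "continuous_on {0..1} w"
    and N: "N > 0"
  defines "h \<equiv> 2 * K / real N"
  defines "S \<equiv> - K * (w 1 - w 0) + h * (\<Sum>k<N. w 1 - w (cdf_of M Z (real k * h - K)))"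
  shows "S - h * (w 1 - w 0) \<le> stieltjes_01 w (quantile M Z)"
    and "stieltjes_01 w (quantile M Z) \<le> S"
proof -
  interpret prob_space M by fact
  \<comment> \<open>The constant extension used in \<open>stieltjes_01\<close>; it is monotone and
    continuous on the whole line, as needed to evaluate \<open>interval_measure\<close> on
    intervals.\<close>
  define W where "W x = w (max 0 (min 1 x))" for x
  define \<nu> where "\<nu> = interval_measure W"
  have sets_\<nu> [measurable_cong]: "sets \<nu> = sets borel" by (simp add: \<nu>_def)
  have W_mono: "W x \<le> W y" if "x \<le> y" for x y
    unfolding W_def using that by (intro mono_onD[OF w(1)]) auto
  have "continuous_on UNIV W"
    unfolding W_def
    by (intro continuous_on_compose2[OF w(2)] continuous_intros) auto
  then have W_cont: "continuous (at_right a) W" for a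
    by (meson UNIV_I continuous_at_imp_continuous_at_within continuous_on_eq_continuous_at open_UNIV)
  have em: "emeasure \<nu> {a<..1} = ennreal (w 1 - w a)" if "0 \<le> a" "a \<le> 1" for a
    unfolding \<nu>_def using that W_mono W_cont
    by (subst emeasure_interval_measure_Ioc) (auto simp: W_def)
  have hbi: "has_bochner_integral \<nu> (indicat_real {a<..1}) (w 1 - w a)" if "0 \<le> a" "a \<le> 1" for a
  proof -
    have "w a \<le> w 1" using w(1) that by (auto intro: mono_onD)
    then show ?thesis
      using that has_bochner_integral_real_indicator[of "{a<..1}" \<nu>]
      by (simp add: em measure_def)
  qed
  have F01: "0 \<le> cdf_of M Z t" "cdf_of M Z t \<le> 1" for t
    by (auto simp: cdf_of_def)
  let ?q = "quantile M Z"
  let ?s = "\<lambda>p. - K * indicat_real {0<..1} p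
    + h * (\<Sum>k<N. indicat_real {cdf_of M Z (real k * h - K)<..1} p)"
  have s: "has_bochner_integral \<nu> ?s S"
    unfolding S_def using F01
    by (intro has_bochner_integral_add has_bochner_integral_mult_right has_bochner_integral_sum
        hbi) auto
  have h: "h > 0" "real N * h = 2 * K" using K N by (auto simp: h_def)
  have bounds: "?s p - h * indicat_real {0<..1} p \<le> indicat_real {0<..1} p * ?q p
      \<and> indicat_real {0<..1} p * ?q p \<le> ?s p" for p
  proof (cases "p \<in> {0<..1}")
    case True
    then have p: "0 < p" "p \<le> 1" by auto
    note q = quantile_bounds[OF assms(1) Z K(1) p]
    have "indicat_real {cdf_of M Z (real k * h - K)<..1} p = of_bool (real k * h < ?q p + K)" for k
      using quantile_less_iff[OF assms(1) Z K(1) p, of "real k * h - K"] p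
      by (auto simp: indicator_def)
    then have "?s p = - K + h * (\<Sum>k<N. of_bool (real k * h < ?q p + K))"
      using True by simp
    then show ?thesis
      using step_approximation[of h "?q p + K" N] h q True by simp
  next
    case False
    then have "indicat_real {cdf_of M Z (real k * h - K)<..1} p = 0" for k
      using F01(1)[of "real k * h - K"] by (auto simp: indicator_def)
    then show ?thesis using False by simp
  qed
  \<comment> \<open>Monotonicity yields measurability. It is restricted to \<open>{0<..1}\<close>
    because elsewhere the infimum defining the quantile runs over an unbounded or empty set.\<close>
  have "mono_on {0<..1} ?q"
  proof (rule mono_onI)
    fix p p' :: real
    assume p: "p \<in> {0<..1}" "p' \<in> {0<..1}" "p \<le> p'"
    show "?q p \<le> ?q p'"
      using quantile_less_iff[OF assms(1) Z K(1), of p "?q p'"]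
        quantile_less_iff[OF assms(1) Z K(1), of p' "?q p'"] p by force
  qed
  then have "?q \<in> borel_measurable (restrict_space borel {0<..1})"
    by (rule borel_measurable_mono_on_fnc)
  then have "(\<lambda>p. indicat_real {0<..1} p * ?q p) \<in> borel_measurable borel"
    by (simp add: borel_measurable_restrict_space_iff)
  then have meas: "(\<lambda>p. indicat_real {0<..1} p * ?q p) \<in> borel_measurable \<nu>"
    by measurable
  have one: "has_bochner_integral \<nu> (indicat_real {0<..1}) (w 1 - w 0)"
    by (rule hbi) auto
  have int: "integrable \<nu> (\<lambda>p. indicat_real {0<..1} p * ?q p)"
  proof (rule Bochner_Integration.integrable_bound)
    show "integrable \<nu> (\<lambda>p. K * indicat_real {0<..1} p)"
      using one by (auto simp: has_bochner_integral_iff)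
    show "AE p in \<nu>. norm (indicat_real {0<..1} p * ?q p) \<le> norm (K * indicat_real {0<..1} p)"
      using quantile_bounds[OF assms(1) Z K(1)] K(2)
      by (intro AE_I2) (auto simp: indicator_def abs_le_iff minus_le_iff)
  qed (rule meas)
  have st: "stieltjes_01 w ?q = (\<integral>p. indicat_real {0<..1} p * ?q p \<partial>\<nu>)"
    by (simp add: stieltjes_01_def set_lebesgue_integral_def \<nu>_def W_def[abs_def])
  have "(\<integral>p. indicat_real {0<..1} p * ?q p \<partial>\<nu>) \<le> (\<integral>p. ?s p \<partial>\<nu>)"
    using int s bounds by (intro integral_mono) (auto simp: has_bochner_integral_iff)
  then show "stieltjes_01 w ?q \<le> S"
    using s st by (simp add: has_bochner_integral_iff)
  have low: "has_bochner_integral \<nu> (\<lambda>p. ?s p - h * indicat_real {0<..1} p) (S - h * (w 1 - w 0))"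
    by (intro has_bochner_integral_diff s has_bochner_integral_mult_right one)
  have "(\<integral>p. ?s p - h * indicat_real {0<..1} p \<partial>\<nu>) \<le> (\<integral>p. indicat_real {0<..1} p * ?q p \<partial>\<nu>)"
    using int low bounds by (intro integral_mono) (auto simp: has_bochner_integral_iff)
  then show "S - h * (w 1 - w 0) \<le> stieltjes_01 w ?q"
    using low st by (simp add: has_bochner_integral_iff)
qed

section \<open>Certainty equivalents\<close>

lemma bounded_rvs_const [simp]: "(\<lambda>_. c) \<in> bounded_rvs M"
  by (auto simp: bounded_rvs_def)

lemma bounded_rvs_add [simp]:
  assumes "Z \<in> bounded_rvs M" "V \<in> bounded_rvs M"
  shows "(\<lambda>x. Z x + V x) \<in> bounded_rvs M"
proof -
  obtain a b where "AE x in M. \<bar>Z x\<bar> \<le> a" "AE x in M. \<bar>V x\<bar> \<le> b"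
    using assms by (auto simp: bounded_rvs_def)
  then have "AE x in M. \<bar>Z x + V x\<bar> \<le> a + b" by eventually_elim linarith
  then show ?thesis using assms by (auto simp: bounded_rvs_def)
qed

lemma bounded_rvs_cmult [simp]:
  assumes "Z \<in> bounded_rvs M"
  shows "(\<lambda>x. c * Z x) \<in> bounded_rvs M"
proof -
  obtain a where "AE x in M. \<bar>Z x\<bar> \<le> a"
    using assms by (auto simp: bounded_rvs_def)
  then have "AE x in M. \<bar>c * Z x\<bar> \<le> \<bar>c\<bar> * a"
    by eventually_elim (simp add: abs_mult mult_left_mono)
  then show ?thesis using assms by (auto simp: bounded_rvs_def)
qed

lemma bounded_rvs_diff [simp]:
  "Z \<in> bounded_rvs M \<Longrightarrow> V \<in> bounded_rvs M \<Longrightarrow> (\<lambda>x. Z x - V x) \<in> bounded_rvs M"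
  using bounded_rvs_add[OF _ bounded_rvs_cmult[of V M "- 1"], of Z] by simp

lemma bounded_rvs_indicator [simp]:
  "A \<in> sets M \<Longrightarrow> indicat_real A \<in> bounded_rvs M"
  unfolding bounded_rvs_def by (auto intro!: exI[of _ 1] simp: indicator_def)

lemma bounded_rvs_sum [simp]:
  "(\<And>k. k \<in> I \<Longrightarrow> Z k \<in> bounded_rvs M) \<Longrightarrow> (\<lambda>x. \<Sum>k\<in>I. Z k x) \<in> bounded_rvs M"
  by (induction I rule: infinite_finite_induct) auto

lemma comonotonic_const [simp]: "comonotonic M (\<lambda>_. c) V" "comonotonic M Z (\<lambda>_. c)"
  by (auto simp: comonotonic_def)

lemma comonotonic_cmult:
  assumes "comonotonic M Z V" "a \<ge> 0" "b \<ge> 0"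
  shows "comonotonic M (\<lambda>x. a * Z x) (\<lambda>x. b * V x)"
  unfolding comonotonic_def
proof (intro ballI)
  fix x y assume "x \<in> space M" "y \<in> space M"
  then have "0 \<le> (a * b) * ((Z x - Z y) * (V x - V y))"
    using assms by (auto simp: comonotonic_def)
  then show "0 \<le> (a * Z x - a * Z y) * (b * V x - b * V y)"
    by (simp add: algebra_simps)
qed

lemma comonotonic_add_const:
  "comonotonic M Z V \<Longrightarrow> comonotonic M (\<lambda>x. Z x + c) V"
  by (auto simp: comonotonic_def)

text \<open>A preimage under an indicator is the whole space, the event, its complement or empty.
  Through this lemma law invariance reduces indicators to probabilities.\<close>

lemma distr_indicator_cong:
  assumes "prob_space M" "A \<in> sets M" "B \<in> sets M" "measure M A = measure M B"
  shows "distr M borel (indicat_real A) = distr M borel (indicat_real B)"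
proof (rule measure_eqI)
  interpret prob_space M by fact
  have [simp]: "A \<inter> space M = A" "B \<inter> space M = B"
    using assms sets.sets_into_space by auto
  have AB: "emeasure M A = emeasure M B" using assms by (simp add: emeasure_eq_measure)
  moreover have "emeasure M (space M - A) = emeasure M (space M - B)"
    using assms by (simp add: emeasure_eq_measure prob_compl)
  moreover have "indicat_real C -` X \<inter> space M =
    (if 1 \<in> X then if 0 \<in> X then space M else C \<inter> space M
     else if 0 \<in> X then space M - C else {})" for C X
    by (auto simp: indicator_def of_bool_def split: if_splits)
  ultimately show "emeasure (distr M borel (indicat_real A)) X
      = emeasure (distr M borel (indicat_real B)) X"
    if "X \<in> sets (distr M borel (indicat_real A))" for X
    using that assms by (simp add: emeasure_distr)
qed simp

text \<open>\<open>nontrivial\<close> excludes total indifference, under which every constant would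
  be a certainty equivalent; the theorem treats that case separately.\<close>

locale dual_preference = prob_space M for M :: "'a measure" +
  fixes R :: "('a \<Rightarrow> real) \<Rightarrow> ('a \<Rightarrow> real) \<Rightarrow> bool"
  assumes atomless: "atomless M"
    and preorder: "total_preorder_on (bounded_rvs M) R"
    and law_inv: "law_invariant M R"
    and cont: "pref_continuous M R"
    and monot: "pref_monotonic M R"
    and dual_indep: "dual_independence M R"
    and nontrivial: "\<exists>Z\<in>bounded_rvs M. \<exists>V\<in>bounded_rvs M. strict R Z V"
begin

lemma R_trans:
  assumes "Z \<in> bounded_rvs M" "V \<in> bounded_rvs M" "W \<in> bounded_rvs M" "R Z V" "R V W"
  shows "R Z W"
  using preorder assms unfolding total_preorder_on_def by blast

lemma R_total: "Z \<in> bounded_rvs M \<Longrightarrow> V \<in> bounded_rvs M \<Longrightarrow> R Z V \<or> R V Z"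
  using preorder unfolding total_preorder_on_def by blast

lemma R_mono:
  "Z \<in> bounded_rvs M \<Longrightarrow> V \<in> bounded_rvs M \<Longrightarrow> AE x in M. V x \<le> Z x \<Longrightarrow> R Z V"
  using monot unfolding pref_monotonic_def by blast

lemma strict_trans:
  assumes "Z' \<in> bounded_rvs M" "Z \<in> bounded_rvs M" "V \<in> bounded_rvs M" "V' \<in> bounded_rvs M"
    and "R Z' Z" "strict R Z V" "R V V'"
  shows "strict R Z' V'"
  using assms R_trans unfolding strict_def by metis

lemma R_cong:
  assumes "Z \<in> bounded_rvs M" "Z' \<in> bounded_rvs M" "V \<in> bounded_rvs M" "V' \<in> bounded_rvs M"
    and "R Z Z'" "R Z' Z" "R V V'" "R V' V"
  shows "R Z V \<longleftrightarrow> R Z' V'"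
  using assms R_trans by metis

text \<open>Strict preference between some constants \<open>K\<close> and \<open>-K\<close> spreads to all translates by mixing
  with a suitable multiple of \<open>Z\<close>, because constants are comonotonic with everything.\<close>

lemma strict_add_const:
  assumes Z: "Z \<in> bounded_rvs M" and "d > 0"
  shows "strict R (\<lambda>x. Z x + d) Z"
proof -
  obtain Z0 V0 where ZV: "Z0 \<in> bounded_rvs M" "V0 \<in> bounded_rvs M" "strict R Z0 V0"
    using nontrivial by blast
  obtain a b where "AE x in M. \<bar>Z0 x\<bar> \<le> a" "AE x in M. \<bar>V0 x\<bar> \<le> b"
    using ZV by (auto simp: bounded_rvs_def)
  then have "AE x in M. Z0 x \<le> max 1 (max a b)" "AE x in M. - max 1 (max a b) \<le> V0 x"
    by (eventually_elim, linarith)+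
  then obtain K where K: "K > 0" "AE x in M. Z0 x \<le> K" "AE x in M. - K \<le> V0 x"
    by (metis less_max_iff_disj zero_less_one)
  have "R (\<lambda>_. K) Z0" "R V0 (\<lambda>_. - K)" using K ZV by (auto intro!: R_mono)
  then have s: "strict R (\<lambda>_. K) (\<lambda>_. - K)"
    using ZV by (intro strict_trans[OF _ _ _ _ _ ZV(3)]) auto
  \<comment> \<open>The first bound keeps \<open>\<alpha> < 1\<close>, the second keeps the gap
    \<open>2 * \<alpha> * K\<close> between the two mixtures below or at \<open>d\<close>;
    monotonicity covers the rest.\<close>
  define \<alpha> where "\<alpha> = min (1/2) (d / (2 * K))"
  have \<alpha>: "0 < \<alpha>" "\<alpha> < 1" using K \<open>d > 0\<close> by (auto simp: \<alpha>_def)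
  have "\<alpha> \<le> d / (2 * K)" by (simp add: \<alpha>_def)
  then have \<alpha>d: "2 * \<alpha> * K \<le> d" using K by (simp add: field_simps)
  \<comment> \<open>Solved so that mixing \<open>W\<close> with the constant \<open>- K\<close>
    returns exactly \<open>Z\<close>.\<close>
  define W where "W x = 1 / (1 - \<alpha>) * (Z x + \<alpha> * K)" for x
  have "W \<in> bounded_rvs M"
    unfolding W_def[abs_def] using Z by (intro bounded_rvs_cmult bounded_rvs_add) auto
  then have "strict R (\<lambda>x. \<alpha> * K + (1 - \<alpha>) * W x) (\<lambda>x. \<alpha> * - K + (1 - \<alpha>) * W x)"
    using dual_indep[unfolded dual_independence_def, rule_format, of "\<lambda>_. K" "\<lambda>_. - K" W \<alpha>] s \<alpha>
    by simp
  moreover have "(1 - \<alpha>) * W x = Z x + \<alpha> * K" for x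
    using \<alpha> by (simp add: W_def)
  then have "(\<lambda>x. \<alpha> * K + (1 - \<alpha>) * W x) = (\<lambda>x. Z x + 2 * \<alpha> * K)"
    "(\<lambda>x. \<alpha> * - K + (1 - \<alpha>) * W x) = Z"
    by (auto simp: fun_eq_iff)
  ultimately have ZZ: "strict R (\<lambda>x. Z x + 2 * \<alpha> * K) Z" by simp
  have "R (\<lambda>x. Z x + d) (\<lambda>x. Z x + 2 * \<alpha> * K)"
    using Z \<alpha>d by (intro R_mono) auto
  moreover have "R Z Z" using Z by (auto intro: R_mono)
  ultimately show ?thesis
    using Z by (intro strict_trans[OF _ _ _ _ _ ZZ]) auto
qed

text \<open>Continuity is used along the shifts \<open>V + 1 / (n + 1)\<close>. This lemma and its
  mirror image remove the small constants introduced to obtain strict preferences.\<close>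

lemma R_limit_above:
  assumes "V \<in> bounded_rvs M" "Z \<in> bounded_rvs M" "\<And>e. e > 0 \<Longrightarrow> R (\<lambda>x. V x + e) Z"
  shows "R V Z"
proof -
  have "L1_closed M {V\<in>bounded_rvs M. R V Z}"
    using cont assms unfolding pref_continuous_def by blast
  moreover have "(\<lambda>n. \<integral>x. \<bar>(V x + 1 / real (Suc n)) - V x\<bar> \<partial>M) \<longlonglongrightarrow> 0"
    using LIMSEQ_inverse_real_of_nat by (simp add: prob_space inverse_eq_divide)
  ultimately show ?thesis
    unfolding L1_closed_def using assms(1) assms(3)
    by (auto dest!: spec[of _ "\<lambda>n x. V x + 1 / real (Suc n)"])
qed

lemma R_limit_below:
  assumes "V \<in> bounded_rvs M" "Z \<in> bounded_rvs M" "\<And>e. e > 0 \<Longrightarrow> R Z (\<lambda>x. V x - e)"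
  shows "R Z V"
proof -
  have "L1_closed M {V\<in>bounded_rvs M. R Z V}"
    using cont assms unfolding pref_continuous_def by blast
  moreover have "(\<lambda>n. \<integral>x. \<bar>(V x - 1 / real (Suc n)) - V x\<bar> \<partial>M) \<longlonglongrightarrow> 0"
    using LIMSEQ_inverse_real_of_nat by (simp add: prob_space inverse_eq_divide)
  ultimately show ?thesis
    unfolding L1_closed_def using assms(1) assms(3)
    by (auto dest!: spec[of _ "\<lambda>n x. V x - 1 / real (Suc n)"])
qed

lemma R_const_iff: "R (\<lambda>_. a) (\<lambda>_. b) \<longleftrightarrow> b \<le> a"
proof
  show "b \<le> a" if "R (\<lambda>_. a) (\<lambda>_. b)"
    using that strict_add_const[of "\<lambda>_. a" "b - a"] by (force simp: strict_def)
qed (auto intro: R_mono)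

text \<open>The infimum of the constants weakly preferred to \<open>Z\<close> works: constants above
  it are preferred to \<open>Z\<close>, by totality \<open>Z\<close> is preferred to those below it,
  and both relations pass to the limit.\<close>

lemma certainty_equivalent_exists:
  assumes Z: "Z \<in> bounded_rvs M"
  shows "\<exists>c. R Z (\<lambda>_. c) \<and> R (\<lambda>_. c) Z"
proof -
  obtain K where K: "AE x in M. \<bar>Z x\<bar> \<le> K" using Z by (auto simp: bounded_rvs_def)
  let ?T = "{t. R (\<lambda>_. t) Z}"
  have K1: "K \<in> ?T" using Z K by (auto intro!: R_mono elim!: eventually_mono)
  have K2: "R Z (\<lambda>_. - K)" using Z K by (auto intro!: R_mono elim!: eventually_mono)
  have low: "- K \<le> t" if "t \<in> ?T" for t
    using that K2 R_trans[of "\<lambda>_. t" Z "\<lambda>_. - K"] Z by (simp add: R_const_iff)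
  then have bdd: "bdd_below ?T" by (intro bdd_belowI)
  have "R (\<lambda>_. Inf ?T) Z"
  proof (rule R_limit_above)
    fix e :: real assume "e > 0"
    then obtain t where "t \<in> ?T" "t < Inf ?T + e"
      using cInf_lessD[of ?T "Inf ?T + e"] K1 by fastforce
    then show "R (\<lambda>x. Inf ?T + e) Z"
      using Z R_trans[of "\<lambda>_. Inf ?T + e" "\<lambda>_. t" Z] by (auto simp: R_const_iff)
  qed (use Z in auto)
  moreover have "R Z (\<lambda>_. Inf ?T)"
  proof (rule R_limit_below)
    fix e :: real assume "e > 0"
    then have "Inf ?T - e \<notin> ?T" using cInf_lower[OF _ bdd, of "Inf ?T - e"] by linarith
    then show "R Z (\<lambda>x. Inf ?T - e)" using R_total[OF Z bounded_rvs_const] by auto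
  qed (use Z in auto)
  ultimately show ?thesis by blast
qed

text \<open>The choice is unique on \<open>bounded_rvs M\<close>, since indifferent constants are
  equal by \<open>R_const_iff\<close>.\<close>

definition ce :: "('a \<Rightarrow> real) \<Rightarrow> real" where
  "ce Z = (SOME c. R Z (\<lambda>_. c) \<and> R (\<lambda>_. c) Z)"

lemma R_ce:
  assumes "Z \<in> bounded_rvs M"
  shows "R Z (\<lambda>_. ce Z)" "R (\<lambda>_. ce Z) Z"
  using someI_ex[OF certainty_equivalent_exists[OF assms]] by (auto simp: ce_def)

text \<open>Thus \<open>ce\<close> already represents the preference; it remains to identify it as
  an integral.\<close>

lemma R_iff_ce:
  assumes "Z \<in> bounded_rvs M" "V \<in> bounded_rvs M"
  shows "R Z V \<longleftrightarrow> ce V \<le> ce Z"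
  unfolding R_const_iff[symmetric]
  using R_ce[OF assms(1)] R_ce[OF assms(2)] assms by (intro R_cong) auto

lemma ce_const [simp]: "ce (\<lambda>_. c) = c"
  using R_ce[of "\<lambda>_. c"] by (simp add: R_const_iff)

lemma ce_mono:
  "Z \<in> bounded_rvs M \<Longrightarrow> V \<in> bounded_rvs M \<Longrightarrow> AE x in M. V x \<le> Z x \<Longrightarrow> ce V \<le> ce Z"
  using R_iff_ce R_mono by blast

section \<open>Comonotonic additivity of the certainty equivalent\<close>

text \<open>Dual independence speaks only of strict preference, whereas \<open>Z\<close> and
  \<open>ce Z\<close> are indifferent. Shifting \<open>Z\<close> slightly up or down makes the
  comparison strict and preserves comonotonicity; the shift then tends to 0.\<close>

lemma ce_replace:
  assumes B: "Z \<in> bounded_rvs M" "W \<in> bounded_rvs M"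
    and com: "comonotonic M Z W" and \<alpha>: "0 < \<alpha>" "\<alpha> < 1"
  shows "ce (\<lambda>x. \<alpha> * Z x + (1 - \<alpha>) * W x) = ce (\<lambda>x. \<alpha> * ce Z + (1 - \<alpha>) * W x)"
proof (rule antisym)
  let ?X = "\<lambda>x. \<alpha> * Z x + (1 - \<alpha>) * W x" and ?Y = "\<lambda>x. \<alpha> * ce Z + (1 - \<alpha>) * W x"
  have XY: "?X \<in> bounded_rvs M" "?Y \<in> bounded_rvs M" using B by auto
  have strict_iff: "strict R V V' \<longleftrightarrow> ce V' < ce V"
    if "V \<in> bounded_rvs M" "V' \<in> bounded_rvs M" for V V'
    using that by (auto simp: strict_def R_iff_ce)
  have com': "comonotonic M (\<lambda>x. Z x + e) W" for e
    using com by (rule comonotonic_add_const)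
  have "R ?X ?Y"
  proof (rule R_limit_above)
    fix e :: real assume "e > 0"
    \<comment> \<open>Mixing scales a shift of \<open>Z\<close> by \<open>\<alpha>\<close>, so this
      one becomes exactly \<open>e\<close>.\<close>
    define d where "d = e / \<alpha>"
    have d: "d > 0" "\<alpha> * d = e" using \<alpha> \<open>e > 0\<close> by (auto simp: d_def)
    have "strict R (\<lambda>x. Z x + d) (\<lambda>_. ce Z)"
      using strict_add_const[OF B(1) d(1)] B by (simp add: strict_iff)
    then have "strict R (\<lambda>x. \<alpha> * (Z x + d) + (1 - \<alpha>) * W x) ?Y"
      using dual_indep com' B \<alpha> unfolding dual_independence_def
      by (auto simp del: distrib_left)
    then show "R (\<lambda>x. ?X x + e) ?Y"
      by (simp add: strict_def algebra_simps flip: d(2))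
  qed (use XY in auto)
  then show "ce ?Y \<le> ce ?X" using XY R_iff_ce by blast
  have "R ?Y ?X"
  proof (rule R_limit_below)
    fix e :: real assume "e > 0"
    define d where "d = e / \<alpha>"
    have d: "d > 0" "\<alpha> * d = e" using \<alpha> \<open>e > 0\<close> by (auto simp: d_def)
    have "strict R (\<lambda>_. ce Z) (\<lambda>x. Z x + - d)"
      using strict_add_const[of "\<lambda>x. Z x + - d" d] B d by (simp add: strict_iff)
    moreover have "(\<lambda>x. Z x + - d) \<in> bounded_rvs M" using B by simp
    ultimately have "strict R ?Y (\<lambda>x. \<alpha> * (Z x + - d) + (1 - \<alpha>) * W x)"
      using dual_indep com'[of "- d"] B \<alpha> comonotonic_const bounded_rvs_const
      unfolding dual_independence_def by blast
    then show "R ?Y (\<lambda>x. ?X x - e)"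
      by (simp add: strict_def algebra_simps flip: d(2))
  qed (use XY in auto)
  then show "ce ?X \<le> ce ?Y" using XY R_iff_ce by blast
qed

text \<open>\<open>ce_replace\<close> is used twice: first for \<open>Z\<close>, then for
  \<open>W\<close> with weight \<open>1 - \<alpha>\<close> against the constant
  \<open>ce Z\<close>.\<close>

lemma ce_mix:
  assumes B: "Z \<in> bounded_rvs M" "W \<in> bounded_rvs M"
    and com: "comonotonic M Z W" and \<alpha>: "0 < \<alpha>" "\<alpha> < 1"
  shows "ce (\<lambda>x. \<alpha> * Z x + (1 - \<alpha>) * W x) = \<alpha> * ce Z + (1 - \<alpha>) * ce W"
proof -
  have "ce (\<lambda>x. (1 - \<alpha>) * W x + (1 - (1 - \<alpha>)) * ce Z)
      = ce (\<lambda>x. (1 - \<alpha>) * ce W + (1 - (1 - \<alpha>)) * ce Z)"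
    using B \<alpha> by (intro ce_replace) auto
  then show ?thesis
    using ce_replace[OF assms] by (simp add: add.commute)
qed

text \<open>Mixing with the constant 0 gives factors below 1; a larger factor is undone by its
  reciprocal.\<close>

lemma ce_cmult:
  assumes Z: "Z \<in> bounded_rvs M" and "a > 0"
  shows "ce (\<lambda>x. a * Z x) = a * ce Z"
proof -
  have small: "ce (\<lambda>x. a * V x) = a * ce V"
    if "V \<in> bounded_rvs M" "0 < a" "a < 1" for a V
    using ce_mix[of V "\<lambda>_. 0" a] that by simp
  consider "a < 1" | "a = 1" | "a > 1" by linarith
  then show ?thesis
  proof cases
    case 3
    then have "ce (\<lambda>x. 1 / a * (a * Z x)) = 1 / a * ce (\<lambda>x. a * Z x)"
      using Z by (intro small) auto
    with 3 show ?thesis by (simp add: field_simps)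
  qed (use small assms in auto)
qed

lemma ce_add:
  assumes B: "Z \<in> bounded_rvs M" "W \<in> bounded_rvs M" and com: "comonotonic M Z W"
  shows "ce (\<lambda>x. Z x + W x) = ce Z + ce W"
proof -
  \<comment> \<open>A sum is the even mixture of the doubled summands.\<close>
  have "ce (\<lambda>x. 1/2 * (2 * Z x) + (1 - 1/2) * (2 * W x))
      = 1/2 * ce (\<lambda>x. 2 * Z x) + (1 - 1/2) * ce (\<lambda>x. 2 * W x)"
    using B comonotonic_cmult[OF com, of 2 2] by (intro ce_mix) auto
  then show ?thesis using B by (simp add: ce_cmult)
qed

text \<open>Otherwise a subsequence would stay in a closed contour set of some constant
  \<open>a\<close> that does not contain the limit \<open>V\<close>.\<close>

lemma ce_tendsto:
  assumes Vs: "\<And>n. Vs n \<in> bounded_rvs M" and V: "V \<in> bounded_rvs M"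
    and lim: "(\<lambda>n. \<integral>x. \<bar>Vs n x - V x\<bar> \<partial>M) \<longlonglongrightarrow> 0"
  shows "(\<lambda>n. ce (Vs n)) \<longlonglongrightarrow> ce V"
proof (rule order_tendstoI)
  have closed: "L1_closed M {V\<in>bounded_rvs M. R V (\<lambda>_. a)}"
    "L1_closed M {V\<in>bounded_rvs M. R (\<lambda>_. a) V}" for a
    using cont unfolding pref_continuous_def by auto
  have sub: "(\<lambda>n. \<integral>x. \<bar>Vs (r n) x - V x\<bar> \<partial>M) \<longlonglongrightarrow> 0" if "strict_mono r" for r :: "nat \<Rightarrow> nat"
    using LIMSEQ_subseq_LIMSEQ[OF lim that] by (simp add: o_def)
  show "\<forall>\<^sub>F n in sequentially. a < ce (Vs n)" if "a < ce V" for a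
  proof (rule ccontr)
    assume "\<not> (\<forall>\<^sub>F n in sequentially. a < ce (Vs n))"
    then obtain r :: "nat \<Rightarrow> nat" where r: "strict_mono r" "\<And>n. \<not> a < ce (Vs (r n))"
      using not_eventually_sequentiallyD by blast
    then have "Vs (r n) \<in> {V\<in>bounded_rvs M. R (\<lambda>_. a) V}" for n
      using Vs by (auto simp: R_iff_ce not_less)
    then have "R (\<lambda>_. a) V"
      using closed(2)[of a, unfolded L1_closed_def, rule_format, of "\<lambda>n. Vs (r n)" V]
        sub[OF r(1)] V by auto
    with that V show False by (simp add: R_iff_ce)
  qed
  show "\<forall>\<^sub>F n in sequentially. ce (Vs n) < a" if "ce V < a" for a
  proof (rule ccontr)
    assume "\<not> (\<forall>\<^sub>F n in sequentially. ce (Vs n) < a)"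
    then obtain r :: "nat \<Rightarrow> nat" where r: "strict_mono r" "\<And>n. \<not> ce (Vs (r n)) < a"
      using not_eventually_sequentiallyD by blast
    then have "Vs (r n) \<in> {V\<in>bounded_rvs M. R V (\<lambda>_. a)}" for n
      using Vs by (auto simp: R_iff_ce not_less)
    then have "R V (\<lambda>_. a)"
      using closed(1)[of a, unfolded L1_closed_def, rule_format, of "\<lambda>n. Vs (r n)" V]
        sub[OF r(1)] V by auto
    with that V show False by (simp add: R_iff_ce)
  qed
qed

section \<open>The distortion function\<close>

text \<open>The distortion function. For \<open>p\<close> in \<open>{0..1}\<close> atomlessness
  supplies an event, and by \<open>ce_indicator\<close> its choice does not matter; outside the
  value is arbitrary.\<close>

definition g :: "real \<Rightarrow> real" where
  "g p = ce (indicat_real (SOME A. A \<in> sets M \<and> prob A = p))"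

lemma ce_indicator:
  assumes "A \<in> sets M"
  shows "ce (indicat_real A) = g (prob A)"
proof -
  define A' where "A' = (SOME A'. A' \<in> sets M \<and> prob A' = prob A)"
  have A': "A' \<in> sets M" "prob A' = prob A"
    using someI[of "\<lambda>A'. A' \<in> sets M \<and> prob A' = prob A" A] assms by (auto simp: A'_def)
  have "distr M borel (indicat_real A) = distr M borel (indicat_real A')"
    using A' assms by (intro distr_indicator_cong) (auto intro: prob_space_axioms)
  then have "R (indicat_real A) (indicat_real A')" "R (indicat_real A') (indicat_real A)"
    using law_inv A' assms unfolding law_invariant_def by auto
  then show ?thesis using A' assms by (simp add: R_iff_ce g_def A'_def[symmetric])
qed

text \<open>Either shrink \<open>A\<close> or enlarge it by part of its complement. Nesting makes
  the \<open>L1\<close> distance of the indicators equal to the difference of the probabilities, as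
  \<open>g_continuous\<close> requires.\<close>

lemma event_of_prob:
  assumes "A \<in> sets M" "0 \<le> p" "p \<le> 1"
  shows "\<exists>B\<in>sets M. prob B = p \<and> (B \<subseteq> A \<or> A \<subseteq> B)"
proof (cases "p \<le> prob A")
  case True
  then show ?thesis
    using atomless_subset_of_measure[OF prob_space_axioms atomless assms(1,2)] by blast
next
  case False
  have "\<exists>C\<in>sets M. C \<subseteq> space M - A \<and> prob C = p - prob A"
    using assms False prob_compl[OF assms(1)]
    by (intro atomless_subset_of_measure[OF prob_space_axioms atomless]) auto
  then obtain C where C: "C \<in> sets M" "C \<subseteq> space M - A" "prob C = p - prob A" by blast
  then have "prob (A \<union> C) = p"
    using assms by (subst finite_measure_Union) auto
  then show ?thesis using C assms by (intro bexI[of _ "A \<union> C"]) auto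
qed

lemma g_0 [simp]: "g 0 = 0"
proof -
  have "indicat_real {} = (\<lambda>_ :: 'a. 0)" by auto
  then show ?thesis using ce_indicator[of "{}"] by simp
qed

lemma g_1 [simp]: "g 1 = 1"
proof -
  have "ce (indicat_real (space M)) = ce (\<lambda>_. 1)"
    by (intro antisym ce_mono) auto
  then show ?thesis using ce_indicator[of "space M"] by (simp add: prob_space)
qed

lemma g_mono:
  assumes "0 \<le> p" "p \<le> q" "q \<le> 1"
  shows "g p \<le> g q"
proof -
  obtain B where B: "B \<in> sets M" "prob B = q"
    using event_of_prob[of "{}" q] assms by auto
  obtain A where A: "A \<in> sets M" "A \<subseteq> B" "prob A = p"
    using atomless_subset_of_measure[OF prob_space_axioms atomless, of B p] B assms by auto
  have "ce (indicat_real A) \<le> ce (indicat_real B)"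
    using A B by (intro ce_mono) (auto simp: indicator_def)
  then show ?thesis using A B by (simp add: ce_indicator)
qed

lemma g_continuous: "continuous_on {0..1} g"
  unfolding continuous_on_sequentially
proof (intro allI ballI impI, elim conjE)
  fix ps :: "nat \<Rightarrow> real" and p :: real
  assume p: "p \<in> {0..1}" and ps: "\<forall>n. ps n \<in> {0..1}" "ps \<longlonglongrightarrow> p"
  obtain A where A: "A \<in> sets M" "prob A = p"
    using event_of_prob[of "{}" p] p by auto
  have "\<exists>B\<in>sets M. prob B = ps n \<and> (B \<subseteq> A \<or> A \<subseteq> B)" for n
    using event_of_prob[OF A(1)] ps by auto
  then obtain B where B: "\<And>n. B n \<in> sets M" "\<And>n. prob (B n) = ps n"
    "\<And>n. B n \<subseteq> A \<or> A \<subseteq> B n"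
    by metis
  have "(\<integral>x. \<bar>indicat_real (B n) x - indicat_real A x\<bar> \<partial>M) = \<bar>ps n - p\<bar>" for n
  proof -
    have *: "(\<integral>x. \<bar>indicat_real C x - indicat_real D x\<bar> \<partial>M) = prob D - prob C"
      "(\<integral>x. \<bar>indicat_real D x - indicat_real C x\<bar> \<partial>M) = prob D - prob C"
      "prob C \<le> prob D"
      if "C \<subseteq> D" "C \<in> sets M" "D \<in> sets M" for C D
    proof -
      have eq: "\<bar>indicat_real C x - indicat_real D x\<bar> = indicat_real (D - C) x"
        "\<bar>indicat_real D x - indicat_real C x\<bar> = indicat_real (D - C) x" for x
        using that by (auto simp: indicator_def)
      show "(\<integral>x. \<bar>indicat_real C x - indicat_real D x\<bar> \<partial>M) = prob D - prob C"
        "(\<integral>x. \<bar>indicat_real D x - indicat_real C x\<bar> \<partial>M) = prob D - prob C"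
        "prob C \<le> prob D"
        unfolding eq using that by (simp_all add: finite_measure_Diff finite_measure_mono)
    qed
    show ?thesis using B(3)[of n] *[of "B n" A] *[of A "B n"] A B(1,2) by auto
  qed
  moreover have "(\<lambda>n. \<bar>ps n - p\<bar>) \<longlonglongrightarrow> 0"
    using ps(2) by (intro tendsto_rabs_zero) (simp add: LIM_zero)
  ultimately have "(\<lambda>n. ce (indicat_real (B n))) \<longlonglongrightarrow> ce (indicat_real A)"
    using A B by (intro ce_tendsto) auto
  then show "(g \<circ> ps) \<longlonglongrightarrow> g p"
    using A B by (simp add: ce_indicator o_def)
qed

section \<open>From level sets to the integral representation\<close>

text \<open>Indicators of upper level sets are nondecreasing functions of the same \<open>Z\<close>,
  so each is comonotonic with the sum of the others and \<open>ce_add\<close> applies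
  inductively.\<close>

lemma ce_sum_upper_level_sets:
  fixes N :: nat
  assumes [measurable]: "Z \<in> borel_measurable M"
  shows "ce (\<lambda>x. \<Sum>k<N. indicat_real {x \<in> space M. a k < Z x} x)
    = (\<Sum>k<N. g (1 - cdf_of M Z (a k)))"
proof (induction N)
  case (Suc N)
  let ?A = "\<lambda>k. {x \<in> space M. a k < Z x}"
  have "comonotonic M (\<lambda>x. \<Sum>k<N. indicat_real (?A k) x) (indicat_real (?A N))"
    unfolding comonotonic_def
  proof (intro ballI)
    fix x y assume xy: "x \<in> space M" "y \<in> space M"
    have mono: "indicat_real (?A k) u \<le> indicat_real (?A k) v"
      if "Z u \<le> Z v" "u \<in> space M" "v \<in> space M" for k u v
      using that by (auto simp: indicator_def)
    show "0 \<le> ((\<Sum>k<N. indicat_real (?A k) x) - (\<Sum>k<N. indicat_real (?A k) y))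
        * (indicat_real (?A N) x - indicat_real (?A N) y)"
    proof (cases "Z x \<le> Z y")
      case True
      then show ?thesis using mono[OF _ xy]
        by (intro mult_nonpos_nonpos) (auto intro!: sum_mono)
    next
      case False
      then show ?thesis using mono[OF _ xy(2,1)]
        by (intro mult_nonneg_nonneg) (auto intro!: sum_mono)
    qed
  qed
  then have "ce (\<lambda>x. (\<Sum>k<N. indicat_real (?A k) x) + indicat_real (?A N) x)
    = ce (\<lambda>x. \<Sum>k<N. indicat_real (?A k) x) + ce (indicat_real (?A N))"
    by (intro ce_add bounded_rvs_sum bounded_rvs_indicator) auto
  moreover have "prob (?A N) = 1 - cdf_of M Z (a N)"
    unfolding cdf_of_def
    by (subst prob_compl[symmetric]) (auto intro!: arg_cong[of _ _ prob])
  ultimately show ?case using Suc by (simp add: ce_indicator)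
qed simp

text \<open>The counterpart of \<open>stieltjes_quantile_bounds\<close>. With
  \<open>w p = 1 - g (1 - p)\<close> one has \<open>w 0 = 0\<close>, \<open>w 1 = 1\<close> and
  \<open>w 1 - w F = g (1 - F)\<close>, so both lemmas speak of the same \<open>S\<close>.\<close>

lemma ce_bounds:
  assumes Z [measurable]: "Z \<in> borel_measurable M"
    and K: "AE x in M. \<bar>Z x\<bar> \<le> K" "K > 0" and N: "N > 0"
  defines "h \<equiv> 2 * K / real N"
  defines "S \<equiv> - K + h * (\<Sum>k<N. g (1 - cdf_of M Z (real k * h - K)))"
  shows "S - h \<le> ce Z" "ce Z \<le> S"
proof -
  have h: "h > 0" "real N * h = 2 * K" using K N by (auto simp: h_def)
  let ?T = "\<lambda>x. \<Sum>k<N. indicat_real {x \<in> space M. real k * h - K < Z x} x"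
  have T: "?T \<in> bounded_rvs M" by (intro bounded_rvs_sum bounded_rvs_indicator) auto
  have ZB: "Z \<in> bounded_rvs M" using Z K by (auto simp: bounded_rvs_def)
  have shift: "ce (\<lambda>x. h * ?T x + c) = h * (\<Sum>k<N. g (1 - cdf_of M Z (real k * h - K))) + c" for c
    using T h by (simp add: ce_add ce_cmult ce_sum_upper_level_sets)
  have ae: "AE x in M. h * ?T x - K - h \<le> Z x \<and> Z x \<le> h * ?T x - K"
    using K(1) AE_space
  proof eventually_elim
    case (elim x)
    have "?T x = (\<Sum>k<N. of_bool (real k * h < Z x + K))"
      using elim(2) by (intro sum.cong) (auto simp: indicator_def)
    moreover have "0 \<le> Z x + K" "Z x + K \<le> real N * h"
      using elim(1) h by linarith+
    note step_approximation[OF h(1) this]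
    ultimately show ?case by simp
  qed
  have "ce Z \<le> ce (\<lambda>x. h * ?T x + - K)"
    using ae T ZB
    by (intro ce_mono bounded_rvs_add bounded_rvs_cmult bounded_rvs_const) auto
  then show "ce Z \<le> S" unfolding shift by (simp add: S_def)
  have "ce (\<lambda>x. h * ?T x + (- K - h)) \<le> ce Z"
    using ae T ZB
    by (intro ce_mono bounded_rvs_add bounded_rvs_cmult bounded_rvs_const)
      (auto elim: eventually_mono)
  then show "S - h \<le> ce Z" unfolding shift by (simp add: S_def)
qed

lemma g_reflected_mono: "mono_on {0..1} (\<lambda>p. 1 - g (1 - p))"
  by (auto intro!: mono_onI g_mono)

lemma g_reflected_continuous: "continuous_on {0..1} (\<lambda>p. 1 - g (1 - p))"
  by (intro continuous_intros continuous_on_compose2[OF g_continuous]) auto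

text \<open>The reflection \<open>p \<mapsto> 1 - p\<close> enters because quantiles are counted from below, whereas
  \<open>ce\<close> is computed from the upper level sets of \<open>Z\<close>.\<close>

lemma ce_eq_stieltjes:
  assumes "Z \<in> bounded_rvs M"
  shows "ce Z = stieltjes_01 (\<lambda>p. 1 - g (1 - p)) (quantile M Z)"
proof -
  have Z: "Z \<in> borel_measurable M" using assms by (simp add: bounded_rvs_def)
  obtain K0 where "AE x in M. \<bar>Z x\<bar> \<le> K0" using assms by (auto simp: bounded_rvs_def)
  then have "AE x in M. \<bar>Z x\<bar> \<le> max 1 K0" by eventually_elim linarith
  then obtain K where K: "AE x in M. \<bar>Z x\<bar> \<le> K" "K > 0"
    by (metis less_max_iff_disj zero_less_one)
  let ?U = "stieltjes_01 (\<lambda>p. 1 - g (1 - p)) (quantile M Z)"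
  \<comment> \<open>Both numbers lie in the same interval from \<open>S - h\<close> to
    \<open>S\<close>, whose length \<open>h\<close> vanishes as \<open>N\<close> grows.\<close>
  have le: "\<bar>ce Z - ?U\<bar> \<le> 2 * K / real N" if "N > 0" for N
    using ce_bounds[OF Z K that]
      stieltjes_quantile_bounds[OF prob_space_axioms Z K g_reflected_mono g_reflected_continuous that]
    by (simp add: abs_le_iff)
  have lim: "(\<lambda>n. 2 * K / real (Suc n)) \<longlonglongrightarrow> 0"
    by (rule LIMSEQ_Suc[OF lim_const_over_n])
  have "\<bar>ce Z - ?U\<bar> \<le> 0"
    using le[of "Suc _"] by (intro LIMSEQ_le_const[OF lim]) auto
  then show ?thesis by simp
qed

end

theorem mainTheorem16:
  fixes M :: "'a measure" and R :: "('a \<Rightarrow> real) \<Rightarrow> ('a \<Rightarrow> real) \<Rightarrow> bool"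
  assumes "prob_space M" and "atomless M"
    and "total_preorder_on (bounded_rvs M) R"
    and "law_invariant M R" and "pref_continuous M R"
    and "pref_monotonic M R" and "dual_independence M R"
  shows "\<exists>w :: real \<Rightarrow> real.
           bounded (w ` {0..1}) \<and> mono_on {0..1} w \<and> continuous_on {0..1} w \<and>
           (\<forall>p\<in>{0..1}. w p \<ge> 0) \<and>
           numerical_representation (bounded_rvs M) R
             (\<lambda>Z. stieltjes_01 w (quantile M Z))"
proof (cases "\<exists>Z\<in>bounded_rvs M. \<exists>V\<in>bounded_rvs M. strict R Z V")
  case True
  interpret prob_space M by fact
  interpret dual_preference M R
    using assms True by unfold_locales auto
  let ?w = "\<lambda>p. 1 - g (1 - p)"
  have "bounded (?w ` {0..1})"
    by (intro compact_imp_bounded compact_continuous_image g_reflected_continuous) auto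
  moreover have "?w p \<ge> 0" if "p \<in> {0..1}" for p
    using g_mono[of "1 - p" 1] that by simp
  moreover have "numerical_representation (bounded_rvs M) R
      (\<lambda>Z. stieltjes_01 ?w (quantile M Z))"
    unfolding numerical_representation_def
    by (auto simp: strict_def R_iff_ce simp flip: ce_eq_stieltjes)
  ultimately show ?thesis
    using g_reflected_mono g_reflected_continuous by blast
next
  case False
  \<comment> \<open>Under total indifference the zero weight works: its measure does not charge
    \<open>{0<..1}\<close>, so the utility is constantly 0 and no strict inequality arises.\<close>
  have "stieltjes_01 (\<lambda>_. 0) f = 0" for f
  proof -
    have "emeasure (interval_measure (\<lambda>_. 0 :: real)) {0<..1} = 0"
      by (subst emeasure_interval_measure_Ioc) auto
    then have "AE p in interval_measure (\<lambda>_. 0 :: real). p \<notin> {0<..1}"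
      by (intro AE_not_in) (auto simp: null_sets_def)
    then show ?thesis
      unfolding stieltjes_01_def set_lebesgue_integral_def
      by (intro integral_eq_zero_AE) (auto elim: eventually_mono)
  qed
  then show ?thesis
    using False by (intro exI[of _ "\<lambda>_. 0"]) (auto simp: numerical_representation_def
        mono_on_def image_constant_conv)
qed

end
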